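(* Let $C>0$ and $y_0>0$, and for $k\in\mathbb{R}$ let $$H_2(k)=C\begin{pmatrix}(\cos k-\cosh y_0)^2 & (1-\cos(k-iy_0))^2\\ (1-\cos(k+iy_0))^2 & (\cos k-\cosh y_0)^2\end{pmatrix}.$$ Then $H_2$ is a two-band ($n=2$) Hermitian Bloch Hamiltonian of hopping range $m=2$ whose eigenvalues are $E_f=0$ (an isolated flat band) and $E_1(k)=2C(\cosh y_0-\cos k)^2$ (a dispersive band). The quantum metric length of the flat band is $\ell_{QM}=\coth y_0$, and the inequality $\ell_{QM}\le\frac{N^2}{4}\coth y_{\min}$ holds with equality for $N=(n-1)m=2$, where $y_{\min}$ is the imaginary part of the pole of the flat-band projection $P_f$ in the upper half plane closest to the real axis.
   Context: $P_f(k)$ is the orthogonal projection of $\mathbb{C}^2$ onto $\ker H_2(k)$ for real $k$, extended meromorphically to complex $k$ (its entries are rational functions of $e^{ik}$). The quantum metric of the flat band is $\mathcal{G}(k)=\frac12\mathrm{Tr}[(\partial_kP_f(k))^2]$ and the quantum metric length is $\ell_{QM}=\int_0^{2\pi}\frac{dk}{2\pi}\mathcal{G}(k)$. Hopping range $m$ means that every matrix element is a linear combination of $e^{ilk}$ with $|l|\le m$. For a tight-binding Hamiltonian with $n$ bands and hopping range $m$, $N=(n-1)m$. *)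

theory Defs
  imports "HOL-Complex_Analysis.Complex_Analysis"
begin

definition coth :: "real \<Rightarrow> real" where
  "coth x = cosh x / sinh x"

section \<open>Bloch Hamiltonians\<close>

definition hermitian :: "complex^'n^'n \<Rightarrow> bool" where
  "hermitian A \<longleftrightarrow> (\<forall>i j. A $ i $ j = cnj (A $ j $ i))"

definition hopping_range :: "nat \<Rightarrow> (real \<Rightarrow> complex^'n^'n) \<Rightarrow> bool" where
  "hopping_range m H \<longleftrightarrow>
     (\<forall>i j. \<exists>c :: int \<Rightarrow> complex. \<forall>k.
        H k $ i $ j = (\<Sum>l\<in>{- int m..int m}. c l * exp (\<i> * of_int l * of_real k)))"

definition bloch_hamiltonian :: "nat \<Rightarrow> (real \<Rightarrow> complex^'n^'n) \<Rightarrow> bool" where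
  "bloch_hamiltonian m H \<longleftrightarrow> (\<forall>k. hermitian (H k)) \<and> hopping_range m H"

definition eigenvalues :: "complex^'n^'n \<Rightarrow> complex set" where
  "eigenvalues A = {e. \<exists>v. v \<noteq> 0 \<and> A *v v = e *s v}"

text \<open>Isolated: the band is nondegenerate, and a gap uniform in \<open>k\<close> separates it from the
  rest of the spectrum.\<close>

definition isolated_flat_band :: "(real \<Rightarrow> complex^'n^'n) \<Rightarrow> real \<Rightarrow> bool" where
  "isolated_flat_band H E \<longleftrightarrow>
     (\<forall>k. vec.dim {v. H k *v v = of_real E *s v} = 1) \<and>
     (\<exists>\<Delta>>0. \<forall>k. \<forall>e \<in> eigenvalues (H k) - {of_real E}. \<Delta> \<le> cmod (e - of_real E))"

definition dispersive :: "(real \<Rightarrow> real) \<Rightarrow> bool" where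
  "dispersive E \<longleftrightarrow> \<not> (\<exists>c. \<forall>k. E k = c)"

section \<open>The projection onto the kernel and its meromorphic extension\<close>

text \<open>Orthogonality is with respect to the Hermitian form of \<open>\<complex>\<^sup>n\<close>; the library's \<open>inner\<close> on this
  type is only its real part.\<close>

definition is_orthogonal_projection :: "(complex^'n) set \<Rightarrow> complex^'n^'n \<Rightarrow> bool" where
  "is_orthogonal_projection S P \<longleftrightarrow>
     (\<forall>v. P *v v \<in> S \<and> (\<forall>s\<in>S. (\<Sum>i\<in>UNIV. cnj (s $ i) * (v - P *v v) $ i) = 0))"

definition orthogonal_projection :: "(complex^'n) set \<Rightarrow> complex^'n^'n" where
  "orthogonal_projection S = (THE P. is_orthogonal_projection S P)"

definition ker_projection :: "(real \<Rightarrow> complex^'n^'n) \<Rightarrow> real \<Rightarrow> complex^'n^'n" where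
  "ker_projection H k = orthogonal_projection {v. H k *v v = 0}"

text \<open>\<open>nicely_meromorphic_on\<close> rules out removable singularities and fixes the value 0 at poles,
  which makes the extension unique as a function on \<open>\<complex>\<close>.\<close>

definition is_meromorphic_extension ::
    "(real \<Rightarrow> complex^'n^'n) \<Rightarrow> (complex \<Rightarrow> complex^'n^'n) \<Rightarrow> bool" where
  "is_meromorphic_extension P Q \<longleftrightarrow>
     (\<forall>i j. (\<lambda>z. Q z $ i $ j) nicely_meromorphic_on UNIV) \<and>
     (\<forall>k::real. Q (of_real k) = P k)"

definition meromorphic_extension ::
    "(real \<Rightarrow> complex^'n^'n) \<Rightarrow> complex \<Rightarrow> complex^'n^'n" where
  "meromorphic_extension P = (THE Q. is_meromorphic_extension P Q)"

definition upper_poles :: "(complex \<Rightarrow> complex^'n^'n) \<Rightarrow> complex set" where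
  "upper_poles Q = {p. 0 < Im p \<and> (\<exists>i j. is_pole (\<lambda>z. Q z $ i $ j) p)}"

text \<open>By periodicity the closest pole is not unique, but its imaginary part is.\<close>

definition y_min :: "(real \<Rightarrow> complex^'n^'n) \<Rightarrow> real" where
  "y_min P = Im (arg_min Im (\<lambda>p. p \<in> upper_poles (meromorphic_extension P)))"

section \<open>Quantum metric\<close>

text \<open>For Hermitian \<open>P\<close> the trace is real, so \<open>Re\<close> only changes the type.\<close>

definition quantum_metric :: "(real \<Rightarrow> complex^'n^'n) \<Rightarrow> real \<Rightarrow> real" where
  "quantum_metric P k =
     1/2 * Re (trace (vector_derivative P (at k) ** vector_derivative P (at k)))"

definition quantum_metric_length :: "(real \<Rightarrow> complex^'n^'n) \<Rightarrow> real" where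
  "quantum_metric_length P = integral {0..2*pi} (\<lambda>k. quantum_metric P k / (2*pi))"

section \<open>The two-band model\<close>

definition H2 :: "real \<Rightarrow> real \<Rightarrow> real \<Rightarrow> complex^2^2" where
  "H2 C y0 k = (let \<kappa> = complex_of_real k; y = complex_of_real y0 in
     C *\<^sub>R vector [vector [(cos \<kappa> - cosh y)^2, (1 - cos (\<kappa> - \<i> * y))^2],
                           vector [(1 - cos (\<kappa> + \<i> * y))^2, (cos \<kappa> - cosh y)^2]])"

end

(* With b(z) = 1 - cos(z - i y0) and b'(z) = 1 - cos(z + i y0), which are conjugate for real z,
   one has b b' = (cosh y0 - cos k)^2, so that H2 = C [[b b', b^2], [b'^2, b b']] has rank one and kernel
   spanned by (b, -b'). Hence P_f = 1/2 [[1, -u], [-1/u, 1]] with u = b/b', and its poles are the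
   (double) zeros 2 pi n + i y0 of b and 2 pi n - i y0 of b'. Moreover G = -(D u/u)^2 / 4, and
   D u/u = 2 i sinh y0 / (cosh y0 - cos k). *)

theory Submission
  imports Defs
begin

section \<open>Matrices and orthogonal projections\<close>

text \<open>Limits in a finite product are componentwise. The entry type stays general so that the
  rule applies twice to a matrix: to its rows, then to their entries.\<close>

lemma has_vector_derivative_componentwiseI:
  fixes f :: "real \<Rightarrow> ('a::real_normed_vector)^'n"
  assumes "\<And>i. ((\<lambda>x. f x $ i) has_vector_derivative f' $ i) (at x)"
  shows "(f has_vector_derivative f') (at x)"
  unfolding has_vector_derivative_def has_derivative_within
proof
  show "bounded_linear (\<lambda>t. t *\<^sub>R f')"
    by (rule bounded_linear_scaleR_left)
  show "((\<lambda>t. (1 / norm (t - x)) *\<^sub>R (f t - (f x + (t - x) *\<^sub>R f'))) \<longlongrightarrow> 0) (at x)"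
  proof (rule vec_tendstoI)
    fix i
    show "((\<lambda>t. ((1 / norm (t - x)) *\<^sub>R (f t - (f x + (t - x) *\<^sub>R f'))) $ i) \<longlongrightarrow> 0 $ i) (at x)"
      using assms[of i] unfolding has_vector_derivative_def has_derivative_within by simp
  qed
qed

text \<open>\<open>P v - Q v\<close> lies in \<open>S\<close>; as a difference of two residuals it
  is also orthogonal to \<open>S\<close>, hence to itself, so it is zero.\<close>

lemma is_orthogonal_projection_unique:
  fixes P Q :: "complex^'n^'n"
  assumes P: "is_orthogonal_projection S P" and Q: "is_orthogonal_projection S Q"
    and S: "\<And>u v. u \<in> S \<Longrightarrow> v \<in> S \<Longrightarrow> u - v \<in> S"
  shows "P = Q"
proof -
  have "P *v v = Q *v v" for v
  proof -
    define w where "w = P *v v - Q *v v"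
    have "w \<in> S"
      using P Q S unfolding w_def is_orthogonal_projection_def by blast
    then have "(\<Sum>i\<in>UNIV. cnj (w $ i) * (v - Q *v v) $ i) - (\<Sum>i\<in>UNIV. cnj (w $ i) * (v - P *v v) $ i) = 0"
      using P Q unfolding is_orthogonal_projection_def by simp
    then have "(\<Sum>i\<in>UNIV. cnj (w $ i) * w $ i) = 0"
      by (simp add: w_def sum_subtractf[symmetric] algebra_simps)
    then have "complex_of_real (\<Sum>i\<in>UNIV. (cmod (w $ i))\<^sup>2) = 0"
      by (simp only: of_real_sum complex_norm_square mult.commute[of _ "cnj _"])
    then have "(\<Sum>i\<in>UNIV. (cmod (w $ i))\<^sup>2) = 0"
      by (simp only: of_real_eq_0_iff)
    then have "w = 0"
      by (simp add: sum_nonneg_eq_0_iff vec_eq_iff)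
    then show ?thesis
      by (simp add: w_def)
  qed
  then show ?thesis
    by (simp add: matrix_eq)
qed

section \<open>Meromorphic functions\<close>

text \<open>Identity theorem: the real line accumulates at 0, so the difference cannot avoid 0 there
  and must vanish on a punctured neighbourhood of every point. At the point itself niceness fixes
  the value, as the limit or as 0 at a pole.\<close>

lemma nicely_meromorphic_eqI:
  assumes f: "f nicely_meromorphic_on UNIV" and g: "g nicely_meromorphic_on UNIV"
    and eq: "\<And>x::real. f (of_real x) = g (of_real x)"
  shows "f = g"
proof
  fix z
  have "(\<lambda>z. f z - g z) meromorphic_on UNIV"
    using f g by (auto simp: nicely_meromorphic_on_def intro!: meromorphic_intros)
  from meromorphic_imp_constant_or_avoid[OF this, of 0]
  consider "eventually (\<lambda>z. f z - g z = 0) (cosparse UNIV)"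
    | "eventually (\<lambda>z. f z - g z \<noteq> 0) (cosparse UNIV)" by auto
  then have "eventually (\<lambda>w. f w = g w) (at z)"
  proof cases
    case 1
    then show ?thesis by (auto simp: eventually_cosparse_open_eq)
  next
    case 2
    then have "eventually (\<lambda>z. f z - g z \<noteq> 0) (at 0)"
      by (auto simp: eventually_cosparse_open_eq)
    then obtain d where d: "d > 0" "\<And>w. w \<noteq> 0 \<Longrightarrow> dist w 0 < d \<Longrightarrow> f w - g w \<noteq> 0"
      by (auto simp: eventually_at)
    show ?thesis
      using d(2)[of "of_real (d/2)"] d(1) eq[of "d/2"] by auto
  qed
  note ev = this
  have pole: "is_pole f z \<longleftrightarrow> is_pole g z"
    using ev by (intro is_pole_cong) auto
  have dich: "is_pole h z \<and> h z = 0 \<or> h \<midarrow>z\<rightarrow> h z" if "h nicely_meromorphic_on UNIV" for h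
    using that by (auto simp: nicely_meromorphic_on_def)
  have excl: "\<not> is_pole h z" if "h \<midarrow>z\<rightarrow> h z" for h :: "complex \<Rightarrow> complex"
    using that not_tendsto_and_filterlim_at_infinity[of "at z" h] by (auto simp: is_pole_def)
  show "f z = g z"
  proof (cases "is_pole f z")
    case True
    then show ?thesis using pole dich[OF f] dich[OF g] excl by metis
  next
    case False
    then have "f \<midarrow>z\<rightarrow> f z" "g \<midarrow>z\<rightarrow> g z" using pole dich[OF f] dich[OF g] by auto
    moreover from this(2) have "f \<midarrow>z\<rightarrow> g z"
      using tendsto_cong[OF ev] by blast
    ultimately show ?thesis by (intro LIM_unique)
  qed
qed

lemma is_meromorphic_extension_unique:
  assumes "is_meromorphic_extension P Q" "is_meromorphic_extension P R"
  shows "Q = R"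
proof
  fix z
  have "(\<lambda>z. Q z $ i $ j) = (\<lambda>z. R z $ i $ j)" for i j
    using assms unfolding is_meromorphic_extension_def
    by (intro nicely_meromorphic_eqI) auto
  then show "Q z = R z"
    by (metis vec_eq_iff)
qed

text \<open>The witness \<open>w\<close> shows that \<open>h\<close> is not identically zero, so its
  zero at \<open>z\<close> is isolated.\<close>

lemma is_pole_holomorphic_quotient:
  assumes "g holomorphic_on UNIV" "h holomorphic_on UNIV"
    and "g z \<noteq> 0" "h z = 0" "h w \<noteq> 0"
  shows "is_pole (\<lambda>z. g z / h z) z"
proof (rule is_pole_divide)
  have cont: "isCont f z" if "f holomorphic_on UNIV" for f
    using holomorphic_on_imp_continuous_on[OF that] by (simp add: continuous_on_eq_continuous_at)
  show "isCont g z" using assms(1) by (rule cont)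
  have "eventually (\<lambda>x. h x \<noteq> 0 \<and> x \<in> UNIV) (at z)"
    using assms by (intro non_zero_neighbour_alt[of h UNIV z w]) auto
  then show "filterlim h (at 0) (at z)"
    using cont[OF assms(2)] assms(4) by (auto simp: filterlim_at isCont_def)
qed (use assms in auto)

text \<open>Without common zeros there is no removable singularity, and the convention
  \<open>x / 0 = 0\<close> supplies the value required at poles. If \<open>h\<close> vanishes
  identically, the quotient is the constant 0.\<close>

lemma nicely_meromorphic_on_holomorphic_quotient:
  assumes "g holomorphic_on UNIV" "h holomorphic_on UNIV"
    and "\<And>z. h z = 0 \<Longrightarrow> g z \<noteq> 0"
  shows "(\<lambda>z. g z / h z) nicely_meromorphic_on UNIV"
proof (cases "\<exists>w. h w \<noteq> 0")
  case True
  then obtain w where w: "h w \<noteq> 0" by blast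
  have ana: "g analytic_on A" "h analytic_on A" for A
    using assms(1,2) analytic_on_subset analytic_on_open by (metis open_UNIV subset_UNIV)+
  show ?thesis
    unfolding nicely_meromorphic_on_def
  proof safe
    show "(\<lambda>z. g z / h z) meromorphic_on UNIV"
      by (intro meromorphic_intros analytic_on_imp_meromorphic_on ana)
  next
    fix z
    assume neg: "\<not> (\<lambda>z. g z / h z) \<midarrow>z\<rightarrow> g z / h z"
    have "h z = 0"
    proof (rule ccontr)
      assume "h z \<noteq> 0"
      then have "(\<lambda>z. g z / h z) analytic_on {z}"
        by (intro analytic_intros ana) auto
      then show False
        using neg analytic_at_imp_isCont isContD by blast
    qed
    then show "is_pole (\<lambda>z. g z / h z) z" "g z / h z = 0"
      using is_pole_holomorphic_quotient[OF assms(1,2) assms(3) _ w] by auto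
  qed
qed (auto intro: nicely_meromorphic_on_const)

section \<open>The two-band model\<close>

lemma cosh_complex_of_real: "cosh (complex_of_real x) = of_real (cosh x)"
  and sinh_complex_of_real: "sinh (complex_of_real x) = of_real (sinh x)"
  by (simp_all add: cosh_field_def sinh_field_def exp_of_real flip: of_real_minus)

text \<open>b' is \<open>hop y0\<close> and b is \<open>hop (- y0)\<close>: with a signed parameter
  each fact serves both. The argument is complex so that the same function describes the
  extension.\<close>

definition hop :: "real \<Rightarrow> complex \<Rightarrow> complex" where
  "hop y z = 1 - cos (z + \<i> * of_real y)"

lemma hop_holomorphic: "hop y holomorphic_on A"
  unfolding hop_def[abs_def] by (intro holomorphic_intros)

lemma hop_of_real:
  "hop y (of_real k) = 1 - of_real (cos k * cosh y) + \<i> * of_real (sin k * sinh y)"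
  by (simp add: hop_def cos_add cos_of_real sin_of_real cos_conv_cosh[of "\<i> * _"]
      sin_conv_sinh[of "\<i> * _"] cosh_complex_of_real sinh_complex_of_real)

lemma cnj_hop: "cnj (hop y (of_real k)) = hop (- y) (of_real k)"
  by (simp add: hop_of_real)

text \<open>The factors are conjugate, so this is a squared modulus; writing the squares of
  \<open>sin\<close> and \<open>sinh\<close> through \<open>cos\<close> and \<open>cosh\<close>
  makes it a perfect square.\<close>

lemma hop_mult:
  "hop y (of_real k) * hop (- y) (of_real k) = of_real ((cosh y - cos k)\<^sup>2)"
proof -
  have "(1 - cos k * cosh y)\<^sup>2 + (sin k * sinh y)\<^sup>2 = (cosh y - cos k)\<^sup>2"
    unfolding power_mult_distrib sin_squared_eq sinh_square_eq
    by (simp add: power2_eq_square algebra_simps)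
  then show ?thesis
    by (simp add: hop_of_real complex_eq_iff power2_eq_square algebra_simps)
qed

lemma cosh_minus_cos_pos:
  assumes "y \<noteq> 0"
  shows "cosh y - cos k > (0::real)"
  using cosh_real_ge_1[of y] cosh_real_one_iff[of y] cos_le_one[of k] assms by linarith

lemma hop_of_real_nonzero: "y \<noteq> 0 \<Longrightarrow> hop y (of_real k) \<noteq> 0"
  using hop_mult[of y k] cosh_minus_cos_pos[of y k] by auto

text \<open>\<open>cos\<close> is 1 only at real multiples of 2 pi. For \<open>y \<noteq> 0\<close>
  this keeps the zeros of \<open>hop y\<close> and \<open>hop (- y)\<close> on different horizontal
  lines.\<close>

lemma hop_eq_0_imp_Im: "hop y z = 0 \<Longrightarrow> Im z = - y"
proof -
  assume "hop y z = 0"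
  then have "cos (z + \<i> * of_real y) = 1" by (simp add: hop_def)
  then obtain n :: int where "z + \<i> * of_real y = of_real (2 * n) * of_real pi"
    by (auto simp: cos_eq_1)
  from arg_cong[OF this, of Im] show "Im z = - y" by simp
qed

section \<open>Rank-one form, hopping range and spectrum of the Hamiltonian\<close>

lemma H2_nth:
  "H2 C y k $ 1 $ 1 = of_real C * (hop y (of_real k) * hop (- y) (of_real k))"
  "H2 C y k $ 1 $ 2 = of_real C * (hop (- y) (of_real k))\<^sup>2"
  "H2 C y k $ 2 $ 1 = of_real C * (hop y (of_real k))\<^sup>2"
  "H2 C y k $ 2 $ 2 = of_real C * (hop y (of_real k) * hop (- y) (of_real k))"
  unfolding hop_mult H2_def Let_def vector_scaleR_component vector_2
  by (simp_all add: scaleR_conv_of_real[where 'a = complex] hop_def power2_commute cos_of_real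
      cosh_complex_of_real)

text \<open>The matrix is \<open>C\<close> times the column (b, b') times the row (b', b), so
  \<open>v\<close> enters only through the functional \<open>w\<close>.\<close>

lemma H2_mult_vec:
  fixes v :: "complex^2" and y k :: real
  defines "w \<equiv> hop y (of_real k) * v $ 1 + hop (- y) (of_real k) * v $ 2"
  shows "(H2 C y k *v v) $ 1 = of_real C * hop (- y) (of_real k) * w"
    and "(H2 C y k *v v) $ 2 = of_real C * hop y (of_real k) * w"
  by (simp_all add: w_def matrix_vector_mult_def sum_2 H2_nth power2_eq_square algebra_simps)

lemma H2_kernel_iff:
  assumes "C \<noteq> 0" "y \<noteq> 0"
  shows "H2 C y k *v v = 0 \<longleftrightarrow> hop y (of_real k) * v $ 1 + hop (- y) (of_real k) * v $ 2 = 0"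
  using assms hop_of_real_nonzero[of y k] hop_of_real_nonzero[of "- y" k]
  by (simp add: vec_eq_iff forall_2 H2_mult_vec)

lemma bloch_hamiltonian_H2: "bloch_hamiltonian 2 (H2 C y)"
proof -
  have herm: "hermitian (H2 C y k)" for k
    using cnj_hop[of y k] cnj_hop[of "- y" k]
    by (simp add: hermitian_def forall_2 H2_nth mult.commute)
  \<comment> \<open>Every entry is \<open>C\<close> times the square of a trigonometric polynomial
    of degree one: \<open>p = 1\<close> with \<alpha> = exp (-t), \<beta> = exp t off the diagonal,
    and \<open>p = cosh y\<close> with \<alpha> = \<beta> = 1 on it.\<close>
  have trig: "\<exists>c :: int \<Rightarrow> complex. \<forall>k. r * (p - (\<alpha> * exp (\<i> * of_real k) + \<beta> * exp (- (\<i> * of_real k))) / 2)\<^sup>2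
     = (\<Sum>l\<in>{- int 2..int 2}. c l * exp (\<i> * of_int l * of_real k))" for r p \<alpha> \<beta> :: complex
  proof -
    \<comment> \<open>Coefficients of the expanded square; the cross term joins the constant one
      because the two exponentials cancel.\<close>
    define c where "c = (\<lambda>l::int. if l = -2 then r * \<beta>\<^sup>2/4 else if l = -1 then - r * p * \<beta>
       else if l = 0 then r * (p\<^sup>2 + \<alpha> * \<beta> / 2) else if l = 1 then - r * p * \<alpha> else r * \<alpha>\<^sup>2/4)"
    have set: "{- int 2..int 2} = {-2,-1,0,1,2}" by auto
    have "r * (p - (\<alpha> * exp (\<i> * of_real k) + \<beta> * exp (- (\<i> * of_real k))) / 2)\<^sup>2
     = (\<Sum>l\<in>{- int 2..int 2}. c l * exp (\<i> * of_int l * of_real k))" for k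
    proof -
      define E where "E = exp (\<i> * complex_of_real k)"
      define F where "F = exp (- (\<i> * complex_of_real k))"
      have EF: "E * F = 1" by (simp add: E_def F_def flip: exp_add)
      have 2: "exp (\<i> * 2 * complex_of_real k) = E\<^sup>2" "exp (- (\<i> * 2 * complex_of_real k)) = F\<^sup>2"
        by (simp_all add: E_def F_def power2_eq_square algebra_simps flip: exp_add)
      have "(\<Sum>l\<in>{- int 2..int 2}. c l * exp (\<i> * of_int l * of_real k))
         = r * \<beta>\<^sup>2/4 * F\<^sup>2 - r * p * \<beta> * F + r * (p\<^sup>2 + \<alpha> * \<beta> / 2) - r * p * \<alpha> * E + r * \<alpha>\<^sup>2/4 * E\<^sup>2"
        unfolding set by (simp add: c_def 2 flip: E_def F_def)
      \<comment> \<open>Putting the factor \<open>E * F = 1\<close> back makes the claim a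
        polynomial identity in \<open>E\<close> and \<open>F\<close>.\<close>
      also have "\<dots> = r * \<beta>\<^sup>2/4 * F\<^sup>2 - r * p * \<beta> * F + r * (p\<^sup>2 + \<alpha> * \<beta> / 2 * (E * F)) - r * p * \<alpha> * E + r * \<alpha>\<^sup>2/4 * E\<^sup>2"
        by (simp add: EF)
      also have "\<dots> = r * (p - (\<alpha> * E + \<beta> * F) / 2)\<^sup>2"
        by (simp add: power2_eq_square field_simps)
      finally show ?thesis by (simp add: E_def F_def)
    qed
    then show ?thesis by blast
  qed
  have cos_exp: "cos (of_real k + \<i> * of_real t)
      = (exp (- of_real t) * exp (\<i> * of_real k) + exp (of_real t) * exp (- (\<i> * of_real k))) / 2" for k t
    by (simp add: cos_exp_eq algebra_simps flip: exp_add)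
  have hop2: "\<exists>c :: int \<Rightarrow> complex. \<forall>k. of_real C * (hop t (of_real k))\<^sup>2
      = (\<Sum>l\<in>{- int 2..int 2}. c l * exp (\<i> * of_int l * of_real k))" for t
    unfolding hop_def cos_exp by (rule trig)
  have diag: "\<exists>c :: int \<Rightarrow> complex. \<forall>k. of_real C * (hop y (of_real k) * hop (- y) (of_real k))
      = (\<Sum>l\<in>{- int 2..int 2}. c l * exp (\<i> * of_int l * of_real k))"
  proof -
    have "hop y (of_real k) * hop (- y) (of_real k)
        = (of_real (cosh y) - (1 * exp (\<i> * of_real k) + 1 * exp (- (\<i> * of_real k))) / 2)\<^sup>2" for k
      by (simp add: hop_mult cos_exp_eq flip: cos_of_real)
    then show ?thesis
      using trig[of "of_real C" "of_real (cosh y)" 1 1] by presburger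
  qed
  have "hopping_range 2 (H2 C y)"
    unfolding hopping_range_def forall_2 H2_nth using hop2 diag by blast
  with herm show ?thesis by (simp add: bloch_hamiltonian_def)
qed

text \<open>Applying the functional (b', b) to the eigenvalue equation gives
  \<open>e * w = 2 C b b' w\<close>. Either \<open>e\<close> is that value, or \<open>w = 0\<close>,
  which forces \<open>e v = 0\<close>. Conversely, the functional kills (b, -b') and takes the value
  2 b b' on (b, b').\<close>

lemma eigenvalues_H2:
  assumes "C > 0" "y \<noteq> 0"
  shows "eigenvalues (H2 C y k) = {0, of_real (2 * C * (cosh y - cos k)\<^sup>2)}"
proof -
  define b where "b = hop (- y) (of_real k)"
  define b' where "b' = hop y (of_real k)"
  have nz: "b \<noteq> 0" "b' \<noteq> 0"
    using assms hop_of_real_nonzero[of y k] hop_of_real_nonzero[of "- y" k] by (auto simp: b_def b'_def)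
  have E: "of_real (2 * C * (cosh y - cos k)\<^sup>2) = 2 * of_real C * (b' * b)"
    unfolding b_def b'_def hop_mult by simp
  have H: "H2 C y k *v v = e *s v \<longleftrightarrow>
      of_real C * b * (b' * v $ 1 + b * v $ 2) = e * v $ 1 \<and>
      of_real C * b' * (b' * v $ 1 + b * v $ 2) = e * v $ 2" for e v
    by (simp add: vec_eq_iff[where x = "H2 C y k *v v"] forall_2 H2_mult_vec b_def b'_def)
  show ?thesis
    unfolding E
  proof (intro equalityI subsetI)
    fix e assume "e \<in> eigenvalues (H2 C y k)"
    then obtain v where v: "v \<noteq> 0" "H2 C y k *v v = e *s v" by (auto simp: eigenvalues_def)
    define w where "w = b' * v $ 1 + b * v $ 2"
    have eq: "of_real C * b * w = e * v $ 1" "of_real C * b' * w = e * v $ 2"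
      using v(2) unfolding H w_def by auto
    have "e * w = b' * (e * v $ 1) + b * (e * v $ 2)" by (simp add: w_def algebra_simps)
    also have "\<dots> = 2 * of_real C * (b' * b) * w" by (simp flip: eq)
    finally have "w = 0 \<or> e = 2 * of_real C * (b' * b)" by auto
    moreover have "e = 0" if "w = 0"
      using eq v(1) that by (auto simp: vec_eq_iff forall_2)
    ultimately show "e \<in> {0, 2 * of_real C * (b' * b)}" by auto
  next
    fix e assume "e \<in> {0, 2 * of_real C * (b' * b)}"
    then consider "e = 0" | "e = 2 * of_real C * (b' * b)" by auto
    then show "e \<in> eigenvalues (H2 C y k)"
    proof cases
      case 1
      have "vector [b, - b'] \<noteq> (0::complex^2)" using nz by (simp add: vec_eq_iff forall_2)
      moreover have "H2 C y k *v vector [b, - b'] = e *s vector [b, - b']"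
        unfolding H by (simp add: 1)
      ultimately show ?thesis unfolding eigenvalues_def by blast
    next
      case 2
      have "vector [b, b'] \<noteq> (0::complex^2)" using nz by (simp add: vec_eq_iff forall_2)
      moreover have "H2 C y k *v vector [b, b'] = e *s vector [b, b']"
        unfolding H by (simp add: 2)
      ultimately show ?thesis unfolding eigenvalues_def by blast
    qed
  qed
qed

lemma isolated_flat_band_H2:
  assumes "C > 0" "y \<noteq> 0"
  shows "isolated_flat_band (H2 C y) 0"
  unfolding isolated_flat_band_def
proof (intro conjI allI exI ballI)
  fix k
  define b where "b = hop (- y) (of_real k)"
  define b' where "b' = hop y (of_real k)"
  have nz: "b \<noteq> 0" "b' \<noteq> 0"
    using assms hop_of_real_nonzero[of y k] hop_of_real_nonzero[of "- y" k] by (auto simp: b_def b'_def)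
  define u :: "complex^2" where "u = vector [b, - b']"
  have "{v. H2 C y k *v v = of_real 0 *s v} = vec.span {u}"
  proof (intro equalityI subsetI)
    fix v assume "v \<in> {v. H2 C y k *v v = of_real 0 *s v}"
    then have "b' * v $ 1 + b * v $ 2 = 0"
      using assms by (simp add: H2_kernel_iff b_def b'_def)
    then have "v = (v $ 1 / b) *s u"
      using nz by (simp add: vec_eq_iff forall_2 u_def field_simps eq_neg_iff_add_eq_0)
    then show "v \<in> vec.span {u}" by (metis vec.span_base vec.span_scale singletonI)
  next
    fix v assume "v \<in> vec.span {u}"
    then obtain c where "v = c *s u" by (auto simp: vec.span_singleton)
    then show "v \<in> {v. H2 C y k *v v = of_real 0 *s v}"
      using assms by (simp add: H2_kernel_iff u_def b_def b'_def)
  qed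
  moreover have "u \<noteq> 0" using nz by (simp add: u_def vec_eq_iff forall_2)
  ultimately show "vec.dim {v. H2 C y k *v v = of_real 0 *s v} = 1"
    by simp
next
  \<comment> \<open>The gap is the minimum of the dispersive band, attained where
    \<open>cos k = 1\<close>.\<close>
  show "2 * C * (cosh y - 1)\<^sup>2 > 0"
    using assms cosh_minus_cos_pos[of y 0] by simp
next
  fix k e assume e: "e \<in> eigenvalues (H2 C y k) - {of_real 0}"
  then have "e = of_real (2 * C * (cosh y - cos k)\<^sup>2)"
    using eigenvalues_H2[OF assms] by auto
  then have "cmod (e - of_real 0) = 2 * C * (cosh y - cos k)\<^sup>2"
    using assms by (simp add: norm_mult norm_power flip: of_real_diff)
  moreover have "(cosh y - 1)\<^sup>2 \<le> (cosh y - cos k)\<^sup>2"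
    by (intro power_mono) (use cosh_real_ge_1[of y] in auto)
  ultimately show "2 * C * (cosh y - 1)\<^sup>2 \<le> cmod (e - of_real 0)"
    using assms by simp
qed

section \<open>The flat-band projection\<close>

text \<open>On the real line this is u u^* / (u^* u) for u = (b, -b'); conjugation is written as the
  exchange of b and b', so the formula extends to complex \<open>z\<close>.\<close>

definition flat_projection :: "real \<Rightarrow> complex \<Rightarrow> complex^2^2" where
  "flat_projection y z =
     vector [vector [1/2, - (hop (- y) z / hop y z) / 2],
             vector [- (hop y z / hop (- y) z) / 2, 1/2]]"

lemma is_orthogonal_projection_flat:
  assumes "C \<noteq> 0" "y \<noteq> 0"
  shows "is_orthogonal_projection {v. H2 C y k *v v = 0} (flat_projection y (of_real k))"
  unfolding is_orthogonal_projection_def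
proof (intro allI conjI ballI)
  fix v :: "complex^2"
  define b where "b = hop (- y) (of_real k)"
  define b' where "b' = hop y (of_real k)"
  have nz: "b \<noteq> 0" "b' \<noteq> 0"
    using assms hop_of_real_nonzero[of y k] hop_of_real_nonzero[of "- y" k] by (auto simp: b_def b'_def)
  have Pv: "(flat_projection y (of_real k) *v v) $ 1 = (v $ 1 - b / b' * v $ 2) / 2"
     "(flat_projection y (of_real k) *v v) $ 2 = (v $ 2 - b' / b * v $ 1) / 2"
    by (simp_all add: matrix_vector_mult_def sum_2 flat_projection_def b_def b'_def algebra_simps diff_divide_distrib)
  show "flat_projection y (of_real k) *v v \<in> {v. H2 C y k *v v = 0}"
    using nz assms by (simp add: H2_kernel_iff Pv flip: b_def b'_def) (simp add: field_simps)
  fix s assume "s \<in> {v. H2 C y k *v v = 0}"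
  then have "b' * s $ 1 + b * s $ 2 = 0"
    using assms by (simp add: H2_kernel_iff b_def b'_def)
  from arg_cong[OF this, of cnj] have s: "b * cnj (s $ 1) + b' * cnj (s $ 2) = 0"
    using cnj_hop[of y k] cnj_hop[of "- y" k] by (simp add: b_def b'_def)
  \<comment> \<open>The residual is a multiple of (1/b', 1/b), so its product with \<open>s\<close>
    contains the conjugated kernel equation as a factor.\<close>
  have "(\<Sum>i\<in>UNIV. cnj (s $ i) * (v - flat_projection y (of_real k) *v v) $ i)
     = (b * cnj (s $ 1) + b' * cnj (s $ 2)) * (b' * v $ 1 + b * v $ 2) / (2 * b * b')"
    using nz by (simp add: sum_2 Pv) (simp add: field_simps)
  then show "(\<Sum>i\<in>UNIV. cnj (s $ i) * (v - flat_projection y (of_real k) *v v) $ i) = 0"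
    by (simp add: s)
qed

lemma ker_projection_H2:
  assumes "C \<noteq> 0" "y \<noteq> 0"
  shows "ker_projection (H2 C y) k = flat_projection y (of_real k)"
  unfolding ker_projection_def orthogonal_projection_def
proof (rule the_equality)
  show "is_orthogonal_projection {v. H2 C y k *v v = 0} (flat_projection y (of_real k))"
    using assms by (rule is_orthogonal_projection_flat)
  then show "P = flat_projection y (of_real k)"
    if "is_orthogonal_projection {v. H2 C y k *v v = 0} P" for P
    using that by (elim is_orthogonal_projection_unique) (simp_all add: matrix_vector_mult_diff_distrib)
qed

section \<open>The meromorphic extension and its poles\<close>

lemma is_meromorphic_extension_flat:
  assumes "C \<noteq> 0" "y \<noteq> 0"
  shows "is_meromorphic_extension (ker_projection (H2 C y)) (flat_projection y)"
proof -
  \<comment> \<open>Numerator and denominator vanish only on the lines Im z = t and Im z = -t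
    respectively. The instances \<open>t = y\<close> and \<open>t = - y\<close> give the two
    off-diagonal entries.\<close>
  have q: "(\<lambda>z. hop (- t) z / hop t z) nicely_meromorphic_on UNIV" if "t \<noteq> 0" for t
  proof (rule nicely_meromorphic_on_holomorphic_quotient)
    fix z assume "hop t z = 0"
    then show "hop (- t) z \<noteq> 0"
      using hop_eq_0_imp_Im[of t z] hop_eq_0_imp_Im[of "- t" z] that by auto
  qed (rule hop_holomorphic)+
  have "(\<lambda>z. - (hop (- t) z / hop t z) / 2) nicely_meromorphic_on UNIV" if "t \<noteq> 0" for t
    using nicely_meromorphic_on_cmult_left[OF q[OF that], of "- 1 / 2"] by (simp add: mult.commute)
  from this[of y] this[of "- y"] show ?thesis
    using assms
    by (auto simp: is_meromorphic_extension_def forall_2 flat_projection_def ker_projection_H2)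
qed

lemma meromorphic_extension_H2:
  assumes "C \<noteq> 0" "y \<noteq> 0"
  shows "meromorphic_extension (ker_projection (H2 C y)) = flat_projection y"
  unfolding meromorphic_extension_def
  using is_meromorphic_extension_flat[OF assms] is_meromorphic_extension_unique
  by (intro the_equality) blast+

text \<open>The lower left entry has denominator b, which vanishes at \<open>\<i> * y\<close>. The
  zeros of b' have imaginary part \<open>- y\<close>, so the upper right entry has no pole in the
  upper half plane.\<close>

lemma upper_poles_flat_projection:
  assumes "y > 0"
  shows "\<i> * of_real y \<in> upper_poles (flat_projection y)"
    and "p \<in> upper_poles (flat_projection y) \<Longrightarrow> Im p = y"
proof -
  have pole: "is_pole (\<lambda>z. - hop y z / (2 * hop (- y) z)) (\<i> * of_real y)"
  proof (rule is_pole_holomorphic_quotient)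
    show "- hop y (\<i> * of_real y) \<noteq> 0"
      using hop_eq_0_imp_Im[of y "\<i> * of_real y"] assms by auto
    show "2 * hop (- y) (of_real 0) \<noteq> 0"
      using hop_of_real_nonzero[of "- y" 0] assms by simp
  qed (auto intro!: holomorphic_intros hop_holomorphic simp: hop_def)
  then have "is_pole (\<lambda>z. flat_projection y z $ 2 $ 1) (\<i> * of_real y)"
    by (simp add: flat_projection_def mult.commute)
  then show "\<i> * of_real y \<in> upper_poles (flat_projection y)"
    using assms unfolding upper_poles_def by auto
  assume "p \<in> upper_poles (flat_projection y)"
  then obtain i j where p: "Im p > 0" "is_pole (\<lambda>z. flat_projection y z $ i $ j) p"
    by (auto simp: upper_poles_def)
  show "Im p = y"
  proof (rule ccontr)
    assume "Im p \<noteq> y"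
    then have nz: "hop y p \<noteq> 0" "hop (- y) p \<noteq> 0"
      using hop_eq_0_imp_Im[of y p] hop_eq_0_imp_Im[of "- y" p] p(1) assms by auto
    have hop: "hop t analytic_on {p}" for t
      using hop_holomorphic[of t UNIV] by (simp add: holomorphic_on_imp_analytic_at)
    have "\<forall>i j. (\<lambda>z. flat_projection y z $ i $ j) analytic_on {p}"
      unfolding forall_2 flat_projection_def vector_2
      by (intro conjI analytic_intros hop) (use nz in auto)
    then show False
      using p(2) analytic_at_imp_no_pole by blast
  qed
qed

section \<open>The quantum metric\<close>

text \<open>The addition theorems reduce the numerator of the quotient rule to
  \<open>2 * \<i> * sinh y * (cosh y - cos k)\<close>; \<open>hop_mult\<close> then brings out the
  factor \<open>u k\<close>.\<close>

lemma hop_log_derivative: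
  fixes y k :: real
  defines "u \<equiv> \<lambda>t. hop (- y) (of_real t) / hop y (of_real t)"
  assumes "y \<noteq> 0"
  shows "(u has_vector_derivative u k * (2 * \<i> * of_real (sinh y / (cosh y - cos k)))) (at k)"
proof -
  define \<kappa> where "\<kappa> = complex_of_real k"
  have d: "(hop t has_field_derivative sin (\<kappa> + \<i> * of_real t)) (at \<kappa>)" for t
    unfolding hop_def by (auto intro!: derivative_eq_intros)
  have nz: "hop y \<kappa> \<noteq> 0" "hop (- y) \<kappa> \<noteq> 0"
    using assms hop_of_real_nonzero[of y k] hop_of_real_nonzero[of "- y" k] by (auto simp: \<kappa>_def)
  define a where "a = cosh y - cos k"
  have a: "a > 0" using cosh_minus_cos_pos assms by (auto simp: a_def)
  have sin: "sin (\<kappa> + \<i> * of_real t) = of_real (sin k * cosh t) + \<i> * of_real (cos k * sinh t)" for t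
    by (simp add: \<kappa>_def sin_add cos_of_real sin_of_real cos_conv_cosh[of "\<i> * _"]
        sin_conv_sinh[of "\<i> * _"] cosh_complex_of_real sinh_complex_of_real)
  have "sinh y * (cosh y * (sin k * sin k)) + sinh y * (cosh y * (cos k * cos k)) = sinh y * cosh y"
    using sin_cos_squared_add3[of k] by (simp flip: distrib_left add: add.commute)
  then have "sin (\<kappa> + \<i> * of_real (- y)) * hop y \<kappa> - hop (- y) \<kappa> * sin (\<kappa> + \<i> * of_real y)
      = 2 * \<i> * of_real (sinh y * a)"
    unfolding sin unfolding \<kappa>_def hop_of_real a_def
    by (simp add: complex_eq_iff algebra_simps)
  moreover have hm: "hop y \<kappa> * hop (- y) \<kappa> = of_real (a\<^sup>2)"
    by (simp add: \<kappa>_def hop_mult a_def)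
  ultimately have eq: "(sin (\<kappa> + \<i> * of_real (- y)) * hop y \<kappa> - hop (- y) \<kappa> * sin (\<kappa> + \<i> * of_real y))
       / (hop y \<kappa> * hop y \<kappa>) = hop (- y) \<kappa> / hop y \<kappa> * (2 * \<i> * of_real (sinh y / a))"
    using nz a
    by (simp add: field_simps power2_eq_square)
  have "((\<lambda>z. hop (- y) z / hop y z) has_field_derivative
      hop (- y) \<kappa> / hop y \<kappa> * (2 * \<i> * of_real (sinh y / a))) (at \<kappa>)"
    unfolding eq[symmetric] by (rule DERIV_divide[OF d d nz(1)])
  then show ?thesis
    unfolding u_def \<kappa>_def a_def
    using has_vector_derivative_real_field by blast
qed

text \<open>The derivative of the projection is off-diagonal and its two entries carry reciprocal
  phases, which cancel in the square.\<close>

lemma quantum_metric_H2: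
  assumes "C \<noteq> 0" "y \<noteq> 0"
  shows "quantum_metric (ker_projection (H2 C y)) k = (sinh y)\<^sup>2 / (cosh y - cos k)\<^sup>2"
proof -
  define b where "b = hop (- y) (of_real k)"
  define b' where "b' = hop y (of_real k)"
  have nz: "b \<noteq> 0" "b' \<noteq> 0"
    using assms hop_of_real_nonzero[of y k] hop_of_real_nonzero[of "- y" k] by (auto simp: b_def b'_def)
  define r where "r = sinh y / (cosh y - cos k)"
  define D :: "complex^2^2" where "D = vector [vector [0, - (b / b' * (\<i> * of_real r))],
     vector [b' / b * (\<i> * of_real r), 0]]"
  have P: "ker_projection (H2 C y) = (\<lambda>k. flat_projection y (of_real k))"
    using ker_projection_H2[OF assms] by auto
  have d1: "((\<lambda>t. - (hop (- y) (of_real t) / hop y (of_real t)) / 2) has_vector_derivative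
      - (b / b' * (\<i> * of_real r))) (at k)"
    using has_vector_derivative_mult_right[OF hop_log_derivative[OF assms(2)], of "- 1 / 2" k]
    by (simp add: b_def b'_def r_def mult.commute)
  \<comment> \<open>The reciprocal quotient is the instance \<open>- y\<close>; \<open>sinh\<close>
    being odd changes the sign.\<close>
  have d2: "((\<lambda>t. - (hop y (of_real t) / hop (- y) (of_real t)) / 2) has_vector_derivative
      b' / b * (\<i> * of_real r)) (at k)"
    using has_vector_derivative_mult_right[OF hop_log_derivative[of "- y"], of "- 1 / 2" k] assms(2)
    by (simp add: b_def b'_def r_def mult.commute)
  have "\<forall>i j. ((\<lambda>k. flat_projection y (of_real k) $ i $ j) has_vector_derivative D $ i $ j) (at k)"
    unfolding forall_2 flat_projection_def D_def vector_2
    using d1 d2 by auto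
  then have "(ker_projection (H2 C y) has_vector_derivative D) (at k)"
    unfolding P by (intro has_vector_derivative_componentwiseI) auto
  then have "vector_derivative (ker_projection (H2 C y)) (at k) = D"
    by (rule vector_derivative_at)
  moreover have "trace (D ** D) = of_real (2 * r\<^sup>2)"
    using nz by (simp add: trace_def matrix_matrix_mult_def sum_2 D_def power2_eq_square field_simps)
  ultimately show ?thesis
    by (simp add: quantum_metric_def r_def power_divide)
qed

section \<open>The metric integrated over one period, in closed form\<close>

lemma integral_quantum_metric:
  assumes "y > (0::real)"
  shows "((\<lambda>k. (sinh y)\<^sup>2 / (cosh y - cos k)\<^sup>2) has_integral 2 * pi * coth y) {0..2*pi}"
proof -
  define q where "q = exp (- y)"
  \<comment> \<open>The first summand has derivative \<open>sinh\<^sup>2 y / (cosh y - cos k)\<^sup>2 - cosh y / (cosh y - cos k)\<close>. The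
    second integrates the Poisson kernel \<open>sinh y / (cosh y - cos k) = Re ((1 + w) / (1 - w))\<close>, where
    \<open>w = q exp (i k)\<close>; a primitive is \<open>k - 2 Arg (1 - w)\<close>, and \<open>Re (1 - w) > 0\<close> lets \<open>arctan\<close> express
    the argument without a branch jump in \<open>k\<close>.\<close>
  define F where "F k = sin k / (cosh y - cos k)
     + coth y * (k + 2 * arctan (q * sin k / (1 - q * cos k)))" for k
  have q: "0 < q" "q < 1" using assms by (auto simp: q_def)
  have s: "sinh y > 0" using assms by simp
  have cs: "cosh y = (1/q + q) / 2" "sinh y = (1/q - q) / 2"
    by (simp_all add: cosh_field_def sinh_field_def q_def exp_minus inverse_eq_divide)
  have F: "(F has_real_derivative (sinh y)\<^sup>2 / (cosh y - cos k)\<^sup>2) (at k)" for k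
  proof -
    define x where "x = cos k"
    define a where "a = cosh y - x"
    have a: "a > 0" using cosh_minus_cos_pos[of y k] assms by (simp add: a_def x_def)
    have "q * x < 1"
      using q mult_left_mono[OF cos_le_one[of k], of q] unfolding x_def by linarith
    then have p: "1 - q * x > 0" by simp
    have sq: "(sin k)\<^sup>2 = 1 - x\<^sup>2" by (simp add: x_def sin_squared_eq)
    \<comment> \<open>The squared modulus of \<open>1 - w\<close>;
      \<open>1 + q^2 = 2 * q * cosh y\<close> makes it a multiple of \<open>a\<close>.\<close>
    have norm: "(1 - q * x)\<^sup>2 + q\<^sup>2 * (sin k)\<^sup>2 = 2 * q * a"
      unfolding sq a_def cs using q by (simp add: power2_eq_square field_simps)
    have d1: "((\<lambda>k. sin k / (cosh y - cos k)) has_real_derivative (x * a - (sin k)\<^sup>2) / a\<^sup>2) (at k)"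
      using a by (auto intro!: derivative_eq_intros simp: a_def x_def power2_eq_square)
    have d2: "((\<lambda>k. q * sin k / (1 - q * cos k)) has_real_derivative
        (q * x * (1 - q * x) - q\<^sup>2 * (sin k)\<^sup>2) / (1 - q * x)\<^sup>2) (at k)"
      using p by (auto intro!: derivative_eq_intros simp: x_def power2_eq_square)
    have d3: "((\<lambda>k. arctan (q * sin k / (1 - q * cos k))) has_real_derivative
        (q * x - q\<^sup>2) / (2 * q * a)) (at k)"
    proof -
      have "1 + (q * sin k / (1 - q * x))\<^sup>2 = 2 * q * a / (1 - q * x)\<^sup>2"
        using p norm by (simp add: power_divide power_mult_distrib field_simps)
      moreover have "q * x * (1 - q * x) - q\<^sup>2 * (sin k)\<^sup>2 = q * x - q\<^sup>2"
        unfolding sq by (simp add: power2_eq_square algebra_simps)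
      ultimately show ?thesis
        using p by (intro DERIV_cong[OF DERIV_chain2[OF DERIV_arctan d2]]) (simp add: x_def[symmetric] inverse_eq_divide)
    qed
    have "(F has_real_derivative (x * a - (sin k)\<^sup>2) / a\<^sup>2
        + coth y * (1 + 2 * ((q * x - q\<^sup>2) / (2 * q * a)))) (at k)"
      unfolding F_def by (intro DERIV_add DERIV_cmult DERIV_ident d1 d3)
    \<comment> \<open>As \<open>a + x = cosh y\<close>, the left side is
      \<open>(cosh y - q) / a\<close>, and \<open>cosh y - q = sinh y\<close>.\<close>
    moreover have "1 + 2 * ((q * x - q\<^sup>2) / (2 * q * a)) = sinh y / a"
      using a q by (simp add: field_simps) (simp add: a_def cs field_simps power2_eq_square)
    moreover have "(x * a - (sin k)\<^sup>2) / a\<^sup>2 + coth y * (sinh y / a) = (sinh y)\<^sup>2 / a\<^sup>2"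
    proof -
      have "coth y * (sinh y / a) = cosh y * a / a\<^sup>2"
        using s a by (simp add: coth_def power2_eq_square)
      moreover have "x * a - (sin k)\<^sup>2 + cosh y * a = (sinh y)\<^sup>2"
        unfolding sq sinh_square_eq a_def by (simp add: power2_eq_square algebra_simps)
      ultimately show ?thesis by (simp flip: add_divide_distrib)
    qed
    ultimately show ?thesis by (simp add: a_def x_def)
  qed
  have "((\<lambda>k. (sinh y)\<^sup>2 / (cosh y - cos k)\<^sup>2) has_integral F (2*pi) - F 0) {0..2*pi}"
    using F by (intro fundamental_theorem_of_calculus)
      (auto simp flip: has_real_derivative_iff_has_vector_derivative intro: has_field_derivative_at_within)
  \<comment> \<open>The sine and arctangent terms vanish at both ends; only the linear term
    contributes.\<close>
  then show ?thesis by (simp add: F_def mult_ac)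
qed

text \<open>Equality holds because N^2/4 = 1 and \<open>y_min P_f = y0\<close>. The conjuncts on the
  projection, the extension and the minimiser certify that the choice operators in the definitions
  denote the intended objects.\<close>

theorem mainTheorem3:
  fixes C y0 :: real and n m N :: nat
    and P_f :: "real \<Rightarrow> complex^2^2" and E_1 :: "real \<Rightarrow> real"
  assumes "C > 0" and "y0 > 0"
    and "n = CARD(2)" and "m = 2" and "N = (n - 1) * m"
    and "P_f = ker_projection (H2 C y0)"
    and "E_1 = (\<lambda>k. 2 * C * (cosh y0 - cos k)^2)"
  shows "bloch_hamiltonian m (H2 C y0)
    \<and> (\<forall>k. eigenvalues (H2 C y0 k) = {0, of_real (E_1 k)})
    \<and> isolated_flat_band (H2 C y0) 0
    \<and> dispersive E_1
    \<and> (\<forall>k. is_orthogonal_projection {v. H2 C y0 k *v v = 0} (P_f k))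
    \<and> (\<exists>!Q. is_meromorphic_extension P_f Q)
    \<and> (\<exists>p. is_arg_min Im (\<lambda>p. p \<in> upper_poles (meromorphic_extension P_f)) p)
    \<and> quantum_metric_length P_f = coth y0
    \<and> quantum_metric_length P_f \<le> real N ^ 2 / 4 * coth (y_min P_f)
    \<and> quantum_metric_length P_f = real N ^ 2 / 4 * coth (y_min P_f)
    \<and> N = 2"
proof -
  have nz: "C \<noteq> 0" "y0 \<noteq> 0" using assms by auto
  have N: "N = 2" using assms by simp
  have ext: "meromorphic_extension P_f = flat_projection y0"
    using meromorphic_extension_H2[OF nz] assms by simp
  have ex1: "\<exists>!Q. is_meromorphic_extension P_f Q"
    using is_meromorphic_extension_flat[OF nz] is_meromorphic_extension_unique assms by blast
  note up = upper_poles_flat_projection[OF \<open>y0 > 0\<close>]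
  \<comment> \<open>All upper poles share the imaginary part \<open>y0\<close>, so each of them is a
    minimiser.\<close>
  have argmin: "\<exists>p. is_arg_min Im (\<lambda>p. p \<in> upper_poles (meromorphic_extension P_f)) p"
    unfolding ext is_arg_min_def using up by (metis less_irrefl)
  have "arg_min Im (\<lambda>p. p \<in> upper_poles (meromorphic_extension P_f)) \<in> upper_poles (flat_projection y0)"
    using someI_ex[OF argmin] unfolding arg_min_def ext is_arg_min_def by blast
  then have ymin: "y_min P_f = y0"
    unfolding y_min_def using up(2) by blast
  have len: "quantum_metric_length P_f = coth y0"
  proof -
    have "((\<lambda>k. quantum_metric P_f k / (2 * pi)) has_integral 2 * pi * coth y0 / (2 * pi)) {0..2*pi}"
      using has_integral_divide[OF integral_quantum_metric[OF \<open>y0 > 0\<close>], of "2 * pi"]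
      by (simp add: assms(6) quantum_metric_H2[OF nz])
    then show ?thesis
      unfolding quantum_metric_length_def by (subst integral_unique) auto
  qed
  have disp: "dispersive E_1"
  proof -
    \<comment> \<open>The band values at \<open>k = 0\<close> and \<open>k = pi\<close> are
      compared.\<close>
    have "(cosh y0 - 1)\<^sup>2 < (cosh y0 + 1)\<^sup>2"
      using cosh_real_ge_1[of y0] by (intro power_strict_mono) auto
    then have "E_1 0 \<noteq> E_1 pi" using assms by simp
    then show ?thesis by (metis dispersive_def)
  qed
  show ?thesis
    using bloch_hamiltonian_H2 eigenvalues_H2[OF \<open>C > 0\<close> nz(2)] isolated_flat_band_H2[OF \<open>C > 0\<close> nz(2)]
      disp is_orthogonal_projection_flat[OF nz] ker_projection_H2[OF nz] ex1 argmin len ymin N assms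
    by simp
qed

end
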